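(* Given a set $\mathcal{D}$ of $n$ disks in the plane, one can compute in $O(n)$ time two congruent disks $C_1,C_2$ of common radius $r$ with $\bigcup_{D\in\mathcal{D}}D\subseteq C_1\cup C_2$ and $r\le 2r^*$, where $r^*$ is the smallest radius $\rho$ such that there exist two disks of radius $\rho$ whose union contains $\bigcup_{D\in\mathcal{D}}D$.
   Context: Disks are closed disks in the plane given by center and radius; computations are in the real-RAM model. The paper assumes throughout that no disk of $\mathcal{D}$ contains another disk of $\mathcal{D}$. *)

theory Defs
  imports "HOL-Analysis.Analysis"
begin

text \<open>A minimal real-RAM: registers indexed by naturals holding reals,
integer constants, arithmetic (+,-,*,/, sqrt), indirect addressing through
registers holding natural numbers, comparison jumps. Unit cost per step.\<close>

datatype instr =
    Const nat int
  | Add nat nat nat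
  | Sub nat nat nat
  | Mul nat nat nat
  | Div nat nat nat
  | Sqrt nat nat
  | Load nat nat
  | Store nat nat
  | JmpLe nat nat nat
  | Jmp nat
  | Halt

type_synonym mem = "nat \<Rightarrow> real"
type_synonym config = "nat \<times> mem"

definition addr :: "real \<Rightarrow> nat option" where
  "addr v = (if v \<in> \<nat> then Some (nat \<lfloor>v\<rfloor>) else None)"

definition step :: "instr list \<Rightarrow> config \<Rightarrow> config option" where
  "step P cfg = (case cfg of (pc, m) \<Rightarrow>
     (if pc < length P then
       (case P ! pc of
          Const i c \<Rightarrow> Some (Suc pc, m(i := of_int c))
        | Add i j k \<Rightarrow> Some (Suc pc, m(i := m j + m k))
        | Sub i j k \<Rightarrow> Some (Suc pc, m(i := m j - m k))
        | Mul i j k \<Rightarrow> Some (Suc pc, m(i := m j * m k))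
        | Div i j k \<Rightarrow> Some (Suc pc, m(i := m j / m k))
        | Sqrt i j \<Rightarrow> Some (Suc pc, m(i := sqrt (m j)))
        | Load i j \<Rightarrow> (case addr (m j) of None \<Rightarrow> None | Some a \<Rightarrow> Some (Suc pc, m(i := m a)))
        | Store i j \<Rightarrow> (case addr (m j) of None \<Rightarrow> None | Some a \<Rightarrow> Some (Suc pc, m(a := m i)))
        | JmpLe i j l \<Rightarrow> Some (if m i \<le> m j then l else Suc pc, m)
        | Jmp l \<Rightarrow> Some (l, m)
        | Halt \<Rightarrow> Some (pc, m))
      else None))"

definition halted :: "instr list \<Rightarrow> config \<Rightarrow> bool" where
  "halted P cfg = (fst cfg < length P \<and> P ! fst cfg = Halt)"

fun run :: "instr list \<Rightarrow> nat \<Rightarrow> config \<Rightarrow> config option" where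
  "run P 0 cfg = (if halted P cfg then Some cfg else None)"
| "run P (Suc k) cfg = (if halted P cfg then Some cfg else
      (case step P cfg of None \<Rightarrow> None | Some cfg' \<Rightarrow> run P k cfg'))"

type_synonym disk = "complex \<times> real"

definition disk_set :: "disk \<Rightarrow> complex set" where
  "disk_set d = cball (fst d) (snd d)"

text \<open>Input encoding: register 0 holds n, registers 3i+1, 3i+2, 3i+3 hold
x-coordinate, y-coordinate and radius of disk i; all other registers are 0.\<close>
definition init_mem :: "disk list \<Rightarrow> mem" where
  "init_mem ds = (\<lambda>a. if a = 0 then real (length ds)
      else if a \<le> 3 * length ds then
        (let i = (a - 1) div 3; q = (a - 1) mod 3; d = ds ! i in
          if q = 0 then Re (fst d) else if q = 1 then Im (fst d) else snd d)
      else 0)"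

definition two_center_opt :: "complex set \<Rightarrow> real" where
  "two_center_opt U = Inf {\<rho>. \<rho> \<ge> 0 \<and> (\<exists>a b. U \<subseteq> cball a \<rho> \<union> cball b \<rho>)}"

end

theory Submission
  imports Defs
begin

text \<open>
  Let \<open>U\<close> be the union of the disks, \<open>p1\<close> the centre of one of them, and \<open>p2\<close> a point of \<open>U\<close> farthest
  from \<open>p1\<close>. The output is \<open>p1\<close>, \<open>p2\<close> and the least \<open>r\<close> with \<open>U\<close> contained in the two disks of
  radius \<open>r\<close> about them. Suppose two disks of radius \<open>\<rho>\<close> cover \<open>U\<close>. If both \<open>p1\<close> and \<open>p2\<close> lie in the
  same one, then all of \<open>U\<close> is within \<open>dist p1 p2 \<le> 2\<rho>\<close> of \<open>p1\<close>. Otherwise each of the two contains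
  one of \<open>p1\<close>, \<open>p2\<close>, so every point of \<open>U\<close> is within \<open>2\<rho>\<close> of \<open>p1\<close> or \<open>p2\<close>. Hence \<open>r \<le> 2\<rho>\<close>. Both \<open>p2\<close>
  and \<open>r\<close> are found by a linear scan, since the maximum of \<open>min (dist p1 x) (dist p2 x)\<close> over a single
  disk has a closed form.
\<close>

section \<open>Geometry of two centres\<close>

text \<open>
  With the two centres at \<open>(-L, 0)\<close> and \<open>(L, 0)\<close>, this is the maximal distance to the nearer centre
  over the disk of radius \<open>R\<close> about \<open>(s, t)\<close>, where \<open>s, t \<ge> 0\<close>. The maximum is attained at the point
  of the disk farthest from \<open>(L, 0)\<close> if that point is on the right of the bisector, and otherwise at
  the upper end of the chord cut out of the bisector.
\<close>

definition local_radius :: "real \<Rightarrow> real \<Rightarrow> real \<Rightarrow> real \<Rightarrow> real" where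
  "local_radius L s t R =
     (let d = sqrt ((L - s)\<^sup>2 + t\<^sup>2) in
      if R * (L - s) \<le> s * d then d + R
      else sqrt ((t + sqrt (R\<^sup>2 - s\<^sup>2))\<^sup>2 + L\<^sup>2))"

text \<open>Both sides of the strict inequality are nonnegative, and squaring and cancelling leaves
  \<open>(s * t)^2 < (R^2 - s^2) * (L - s)^2\<close>. Hence the bisector cuts the disk in a genuine
  chord of half-length \<open>w\<close>. The last conclusion is the sign of a multiplier needed in
  \<open>local_radius_upper\<close>.\<close>

lemma chord_case:
  fixes L s t R :: real
  assumes "R > 0" "s \<ge> 0" "t \<ge> 0" and less: "s * sqrt ((L - s)\<^sup>2 + t\<^sup>2) < R * (L - s)"
  defines "w \<equiv> sqrt (R\<^sup>2 - s\<^sup>2)"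
  shows "w > 0" "w\<^sup>2 = R\<^sup>2 - s\<^sup>2" "(t + w) * s \<le> L * w"
proof -
  define d where "d = sqrt ((L - s)\<^sup>2 + t\<^sup>2)"
  have d0: "d \<ge> 0" and d2: "d\<^sup>2 = (L - s)\<^sup>2 + t\<^sup>2" by (auto simp: d_def)
  have "0 \<le> s * d" using assms d0 by simp
  with less have "0 < R * (L - s)" by (simp add: d_def)
  with \<open>R > 0\<close> have Ls: "L - s > 0" by (simp add: zero_less_mult_iff)
  have "(s * d)\<^sup>2 < (R * (L - s))\<^sup>2"
    using less \<open>0 \<le> s * d\<close> by (intro power_strict_mono) (auto simp: d_def)
  hence sq: "s\<^sup>2 * ((L - s)\<^sup>2 + t\<^sup>2) < R\<^sup>2 * (L - s)\<^sup>2"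
    by (simp add: power_mult_distrib d2)
  hence key: "(s * t)\<^sup>2 < (R\<^sup>2 - s\<^sup>2) * (L - s)\<^sup>2"
    by (simp add: algebra_simps power_mult_distrib)
  hence "0 < (R\<^sup>2 - s\<^sup>2) * (L - s)\<^sup>2" by (smt (verit) zero_le_power2)
  hence pos: "R\<^sup>2 - s\<^sup>2 > 0" using Ls by (simp add: zero_less_mult_iff)
  show w0: "w > 0" using pos by (simp add: w_def)
  show w2: "w\<^sup>2 = R\<^sup>2 - s\<^sup>2" using pos by (simp add: w_def)
  have "(s * t)\<^sup>2 \<le> (w * (L - s))\<^sup>2" using key by (simp add: power_mult_distrib w2)
  hence "s * t \<le> w * (L - s)" by (rule power2_le_imp_le) (use w0 Ls in simp)
  thus "(t + w) * s \<le> L * w" by (simp add: algebra_simps)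
qed

text \<open>For \<open>L \<ge> 0\<close>, the half-plane \<open>x \<ge> 0\<close> is where (L, 0) is
  the nearer centre. One branch is the triangle inequality through (s, t); the other is a
  constrained maximum certified by multipliers.\<close>

lemma local_radius_upper:
  fixes L s t R x y :: real
  assumes "R > 0" "s \<ge> 0" "t \<ge> 0" "x \<ge> 0" and D: "(x - s)\<^sup>2 + (y - t)\<^sup>2 \<le> R\<^sup>2"
  shows "sqrt ((x - L)\<^sup>2 + y\<^sup>2) \<le> local_radius L s t R"
proof (cases "R * (L - s) \<le> s * sqrt ((L - s)\<^sup>2 + t\<^sup>2)")
  case True
  have "sqrt ((x - L)\<^sup>2 + y\<^sup>2) = sqrt (((x - s) + (s - L))\<^sup>2 + ((y - t) + t)\<^sup>2)" by simp
  also have "\<dots> \<le> sqrt ((x - s)\<^sup>2 + (y - t)\<^sup>2) + sqrt ((s - L)\<^sup>2 + t\<^sup>2)"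
    by (rule real_sqrt_sum_squares_triangle_ineq)
  also have "sqrt ((x - s)\<^sup>2 + (y - t)\<^sup>2) \<le> R" using D \<open>R > 0\<close> by (simp add: real_le_lsqrt)
  finally show ?thesis using True by (simp add: local_radius_def power2_commute[of s L])
next
  case False
  define w h where "w = sqrt (R\<^sup>2 - s\<^sup>2)" and "h = t + w"
  have w: "w > 0" "w\<^sup>2 = R\<^sup>2 - s\<^sup>2" "h * s \<le> L * w"
    using chord_case[of R s t L] assms False by (auto simp: w_def h_def)
  \<comment> \<open>Lagrange certificate at the chord endpoint (0, h), multiplied by w.\<close>
  have "w * ((x - L)\<^sup>2 + y\<^sup>2 - (h\<^sup>2 + L\<^sup>2)) =
      h * ((x - s)\<^sup>2 + (y - t)\<^sup>2 - (w\<^sup>2 + s\<^sup>2)) - 2 * x * (L * w - h * s) - t * (x\<^sup>2 + (y - h)\<^sup>2)"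
    unfolding h_def by (simp add: power2_eq_square algebra_simps)
  also have "\<dots> \<le> 0"
  proof -
    \<comment> \<open>The multipliers are \<open>h\<close> for the disk and
      \<open>2 * (L * w - h * s)\<close> for the half-plane; the last term is \<open>t\<close> times
      a sum of squares.\<close>
    have "h * ((x - s)\<^sup>2 + (y - t)\<^sup>2 - (w\<^sup>2 + s\<^sup>2)) \<le> 0"
      using D w assms by (intro mult_nonneg_nonpos) (auto simp: h_def)
    moreover have "2 * x * (L * w - h * s) \<ge> 0" "t * (x\<^sup>2 + (y - h)\<^sup>2) \<ge> 0"
      using w assms by auto
    ultimately show ?thesis by linarith
  qed
  finally have "(x - L)\<^sup>2 + y\<^sup>2 \<le> h\<^sup>2 + L\<^sup>2"
    using w(1) by (simp add: mult_le_0_iff)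
  thus ?thesis using False by (simp add: local_radius_def w_def h_def)
qed

lemma local_radius_attained:
  fixes L s t R :: real
  assumes "R > 0" "s \<ge> 0" "t \<ge> 0"
  shows "\<exists>x y. x \<ge> 0 \<and> (x - s)\<^sup>2 + (y - t)\<^sup>2 \<le> R\<^sup>2 \<and> local_radius L s t R \<le> sqrt ((x - L)\<^sup>2 + y\<^sup>2)"
proof (cases "R * (L - s) \<le> s * sqrt ((L - s)\<^sup>2 + t\<^sup>2)")
  case True
  define d where "d = sqrt ((L - s)\<^sup>2 + t\<^sup>2)"
  have d0: "d \<ge> 0" and d2: "d\<^sup>2 = (L - s)\<^sup>2 + t\<^sup>2" by (auto simp: d_def)
  have val: "local_radius L s t R = d + R" using True by (simp add: local_radius_def d_def)
  show ?thesis
  proof (cases "d = 0")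
    case True
    \<comment> \<open>The disk is centred at (L, 0), so all its boundary points are farthest; the
      rightmost one surely has nonnegative abscissa.\<close>
    hence "s = L" "t = 0" using d2 by (auto simp: sum_power2_eq_zero_iff)
    thus ?thesis using assms val True by (intro exI[of _ "s + R"] exI[of _ t]) auto
  next
    case False
    hence dpos: "d > 0" using d0 by simp
    define k where "k = R / d"
    have kd: "k * d = R" using dpos by (simp add: k_def)
    have "k * d * (L - s) \<le> s * d" using True by (simp add: kd flip: d_def)
    hence "d * (k * (L - s)) \<le> d * s" by (simp add: algebra_simps)
    \<comment> \<open>The branch condition, freed of its factor \<open>d\<close>, says that the
      farthest point lies on the right of the bisector.\<close>
    hence x0: "k * (L - s) \<le> s" using dpos by simp
    have "(k * (s - L))\<^sup>2 + (k * t)\<^sup>2 = (k * d)\<^sup>2"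
      unfolding power_mult_distrib[of k d] d2 by (simp add: algebra_simps power2_eq_square)
    moreover have "(s + k * (s - L) - L)\<^sup>2 + (t + k * t)\<^sup>2 = ((1 + k) * d)\<^sup>2"
      unfolding power_mult_distrib[of "1 + k" d] d2 by (simp add: algebra_simps power2_eq_square)
    moreover have "(1 + k) * d = d + R" using kd by (simp add: algebra_simps)
    ultimately show ?thesis using x0 kd val d0 assms
      by (intro exI[of _ "s + k * (s - L)"] exI[of _ "t + k * t"]) (auto simp: algebra_simps)
  qed
next
  case False
  show ?thesis
    using chord_case(2)[of R s t L] assms False
    by (intro exI[of _ 0] exI[of _ "t + sqrt (R\<^sup>2 - s\<^sup>2)"]) (simp add: local_radius_def add.commute)
qed

lemma abs_diff_square_le: "(\<bar>x\<bar> - \<bar>y\<bar>)\<^sup>2 \<le> (x - y)\<^sup>2" for x y :: real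
  by (metis abs_triangle_ineq3 abs_le_square_iff)

text \<open>Multiplication by \<open>cnj u\<close> after translation by \<open>-q\<close> is an
  isometry that moves the centres to \<open>-L\<close> and \<open>L\<close> on the real axis.
  Reflections in both axes then bring the disk centre into the first quadrant, where
  \<open>local_radius\<close> applies. The second conclusion makes \<open>\<rho>\<close>
  tight.\<close>

lemma disk_local_radius:
  fixes q u c :: complex and L R :: real
  assumes u: "cmod u = 1" and "R > 0" "L \<ge> 0"
  defines "z \<equiv> (c - q) * cnj u"
  defines "\<rho> \<equiv> local_radius L \<bar>Re z\<bar> \<bar>Im z\<bar> R"
  defines "p1 \<equiv> q - of_real L * u" and "p2 \<equiv> q + of_real L * u"
  shows "cball c R \<subseteq> cball p1 \<rho> \<union> cball p2 \<rho>"
    and "\<exists>x\<in>cball c R. \<rho> \<le> dist p1 x \<and> \<rho> \<le> dist p2 x"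
proof -
  have uu: "cnj u * u = 1" using u by (metis complex_norm_square mult.commute of_real_1 power_one)
  have iso: "cmod v = cmod (v * cnj u)" for v using u by (simp add: norm_mult)
  have d1: "dist p1 x = sqrt ((Re ((x - q) * cnj u) + L)\<^sup>2 + (Im ((x - q) * cnj u))\<^sup>2)" for x
  proof -
    have "dist p1 x = cmod ((x - p1) * cnj u)" by (simp add: dist_norm norm_minus_commute flip: iso)
    also have "(x - p1) * cnj u = (x - q) * cnj u + of_real L * (cnj u * u)"
      by (simp add: p1_def algebra_simps)
    finally show ?thesis by (simp add: uu cmod_def del: complex_cnj_mult)
  qed
  have d2: "dist p2 x = sqrt ((Re ((x - q) * cnj u) - L)\<^sup>2 + (Im ((x - q) * cnj u))\<^sup>2)" for x
  proof -
    have "dist p2 x = cmod ((x - p2) * cnj u)" by (simp add: dist_norm norm_minus_commute flip: iso)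
    also have "(x - p2) * cnj u = (x - q) * cnj u - of_real L * (cnj u * u)"
      by (simp add: p2_def algebra_simps)
    finally show ?thesis by (simp add: uu cmod_def)
  qed
  have dc: "dist c x = sqrt ((Re ((x - q) * cnj u) - Re z)\<^sup>2 + (Im ((x - q) * cnj u) - Im z)\<^sup>2)" for x
  proof -
    have "dist c x = cmod ((x - c) * cnj u)" by (simp add: dist_norm norm_minus_commute flip: iso)
    also have "(x - c) * cnj u = (x - q) * cnj u - z" by (simp add: z_def algebra_simps)
    finally show ?thesis by (simp add: cmod_def)
  qed
  show "cball c R \<subseteq> cball p1 \<rho> \<union> cball p2 \<rho>"
  proof
    fix x assume "x \<in> cball c R"
    define a b where "a = Re ((x - q) * cnj u)" and "b = Im ((x - q) * cnj u)"
    have "(a - Re z)\<^sup>2 + (b - Im z)\<^sup>2 \<le> R\<^sup>2"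
      using \<open>x \<in> cball c R\<close> dc[of x] unfolding a_def[symmetric] b_def[symmetric]
      by (metis mem_cball sqrt_le_D)
    \<comment> \<open>Folding the point and the disk centre into the first quadrant does not
      increase their distance.\<close>
    hence "(\<bar>a\<bar> - \<bar>Re z\<bar>)\<^sup>2 + (\<bar>b\<bar> - \<bar>Im z\<bar>)\<^sup>2 \<le> R\<^sup>2"
      using abs_diff_square_le[of a "Re z"] abs_diff_square_le[of b "Im z"] by linarith
    hence le: "sqrt ((\<bar>a\<bar> - L)\<^sup>2 + \<bar>b\<bar>\<^sup>2) \<le> \<rho>"
      unfolding \<rho>_def using \<open>R > 0\<close> by (intro local_radius_upper) auto
    show "x \<in> cball p1 \<rho> \<union> cball p2 \<rho>"
    proof (cases "a \<ge> 0")
      case True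
      thus ?thesis using le d2[of x] by (simp add: a_def b_def)
    next
      case False
      hence "(\<bar>a\<bar> - L)\<^sup>2 = (a + L)\<^sup>2" by (simp add: power2_eq_square algebra_simps)
      thus ?thesis using le d1[of x] by (simp add: a_def b_def)
    qed
  qed
  obtain a b where ab: "a \<ge> 0" "(a - \<bar>Re z\<bar>)\<^sup>2 + (b - \<bar>Im z\<bar>)\<^sup>2 \<le> R\<^sup>2"
      "\<rho> \<le> sqrt ((a - L)\<^sup>2 + b\<^sup>2)"
    unfolding \<rho>_def using local_radius_attained[of R "\<bar>Re z\<bar>" "\<bar>Im z\<bar>" L] \<open>R > 0\<close> by auto
  \<comment> \<open>The signs carry the witness from the first quadrant back to the quadrant of
    \<open>z\<close>.\<close>
  define \<sigma> \<tau> :: real where "\<sigma> = (if Re z \<ge> 0 then 1 else -1)" and "\<tau> = (if Im z \<ge> 0 then 1 else -1)"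
  define x where "x = q + Complex (\<sigma> * a) (\<tau> * b) * u"
  have "(x - q) * cnj u = Complex (\<sigma> * a) (\<tau> * b) * (cnj u * u)" by (simp add: x_def)
  hence x: "(x - q) * cnj u = Complex (\<sigma> * a) (\<tau> * b)" by (simp add: uu)
  have "(\<sigma> * a - Re z)\<^sup>2 = (a - \<bar>Re z\<bar>)\<^sup>2" "(\<tau> * b - Im z)\<^sup>2 = (b - \<bar>Im z\<bar>)\<^sup>2"
    by (auto simp: \<sigma>_def \<tau>_def power2_eq_square algebra_simps)
  hence "dist c x \<le> R" using ab(2) \<open>R > 0\<close> by (simp add: dc x real_le_lsqrt)
  \<comment> \<open>On the right side the other centre is at least as far, so the bound holds for
    both.\<close>
  moreover have "(a - L)\<^sup>2 \<le> (a + L)\<^sup>2" using ab(1) \<open>L \<ge> 0\<close> by (intro power2_le_iff_abs_le[THEN iffD2]) auto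
  hence "(a - L)\<^sup>2 \<le> (\<sigma> * a + L)\<^sup>2" "(a - L)\<^sup>2 \<le> (\<sigma> * a - L)\<^sup>2"
    by (auto simp: \<sigma>_def power2_eq_square algebra_simps)
  hence "sqrt ((a - L)\<^sup>2 + b\<^sup>2) \<le> dist p1 x" "sqrt ((a - L)\<^sup>2 + b\<^sup>2) \<le> dist p2 x"
    by (auto simp: d1 d2 x \<tau>_def)
  ultimately show "\<exists>x\<in>cball c R. \<rho> \<le> dist p1 x \<and> \<rho> \<le> dist p2 x"
    using ab(3) by (intro bexI[of _ x]) auto
qed

text \<open>Pigeonhole: two of \<open>p1\<close>, \<open>p2\<close>, \<open>x\<close> lie in the
  same covering disk, and all three pairwise distances are at least \<open>r\<close>, since
  \<open>p2\<close> is at least as far from \<open>p1\<close> as \<open>x\<close> is.\<close>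

lemma two_center_opt_ge:
  assumes "U \<subseteq> cball p1 r \<union> cball p2 r" "r \<ge> 0"
    and "p1 \<in> U" "p2 \<in> U" and far: "\<And>x. x \<in> U \<Longrightarrow> dist p1 x \<le> dist p1 p2"
    and "r = 0 \<or> (\<exists>x\<in>U. r \<le> dist p1 x \<and> r \<le> dist p2 x)"
  shows "r \<le> 2 * two_center_opt U"
proof -
  have bound: "r / 2 \<le> \<rho>" if "\<rho> \<ge> 0" "U \<subseteq> cball a \<rho> \<union> cball b \<rho>" for \<rho> a b
  proof (cases "r = 0")
    case False
    then obtain x where x: "x \<in> U" "r \<le> dist p1 x" "r \<le> dist p2 x" using assms by auto
    have pair: "dist y z \<le> 2 * \<rho>" if "y \<in> cball o' \<rho>" "z \<in> cball o' \<rho>" for y z o'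
      using that dist_triangle3[of y z o'] by simp
    have "p1 \<in> cball a \<rho> \<union> cball b \<rho>" "p2 \<in> cball a \<rho> \<union> cball b \<rho>" "x \<in> cball a \<rho> \<union> cball b \<rho>"
      using subsetD[OF that(2)] \<open>p1 \<in> U\<close> \<open>p2 \<in> U\<close> x(1) by simp_all
    hence "dist p1 p2 \<le> 2 * \<rho> \<or> dist p1 x \<le> 2 * \<rho> \<or> dist p2 x \<le> 2 * \<rho>"
      by (elim UnE) (simp_all only: pair simp_thms)
    thus ?thesis using x far[OF x(1)] by linarith
  qed (use that in auto)
  have "r / 2 \<le> two_center_opt U"
    unfolding two_center_opt_def
  proof (rule cInf_greatest)
    show "{\<rho>. \<rho> \<ge> 0 \<and> (\<exists>a b. U \<subseteq> cball a \<rho> \<union> cball b \<rho>)} \<noteq> {}"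
      using assms(1,2) by blast
  qed (use bound in auto)
  thus ?thesis by simp
qed

section \<open>Execution of real-RAM code\<close>

text \<open>
  Defined through \<open>run\<close>, which is idle on halted configurations, so that \<open>k\<close> is only an upper bound on
  the number of steps.
\<close>

definition reach :: "instr list \<Rightarrow> nat \<Rightarrow> config \<Rightarrow> config \<Rightarrow> bool" where
  "reach P k c c' \<longleftrightarrow> (\<forall>k' c''. run P k' c' = Some c'' \<longrightarrow> run P (k + k') c = Some c'')"

lemma run_halted: "halted P c \<Longrightarrow> run P k c = Some c"
  by (cases k) auto

lemma run_Suc: "run P k c = Some c' \<Longrightarrow> run P (Suc k) c = Some c'"
proof (induction k arbitrary: c)
  case (Suc k)
  thus ?case
    by (cases "halted P c"; cases "step P c")
      (auto simp: run_halted run.simps(2)[of P "Suc k"] run.simps(2)[of P k c] simp del: run.simps(2))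
qed (auto simp: run_halted split: if_splits)

lemma reach_refl: "reach P k c c"
proof -
  have "run P k' c = Some c'' \<Longrightarrow> run P (k + k') c = Some c''" for k' c''
    by (induction k) (auto intro: run_Suc simp del: run.simps)
  thus ?thesis by (simp add: reach_def)
qed

lemma reach_trans: "reach P k c c' \<Longrightarrow> reach P l c' c'' \<Longrightarrow> reach P (k + l) c c''"
  unfolding reach_def by (metis add.assoc)

lemma reach_mono: "reach P k c c' \<Longrightarrow> k \<le> l \<Longrightarrow> reach P l c c'"
  using reach_trans[OF reach_refl[of P "l - k" c], of k c'] by simp

lemma reach_step:
  assumes "step P c = Some c'"
  shows "reach P 1 c c'"
proof (cases "halted P c")
  case True
  hence "c' = c" using assms by (auto simp: halted_def step_def split: prod.splits)
  thus ?thesis by (simp add: reach_refl)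
qed (use assms in \<open>simp add: reach_def\<close>)

lemma reach_halted: "reach P k c c' \<Longrightarrow> halted P c' \<Longrightarrow> run P k c = Some c'"
  unfolding reach_def by (metis add.right_neutral run_halted)

text \<open>Each iteration starts and ends at the loop head \<open>pc\<close>, so the costs add up
  to \<open>n * k\<close>. Leaving the loop is accounted for separately.\<close>

lemma reach_loop:
  assumes "\<And>i m. i < n \<Longrightarrow> I i m \<Longrightarrow> \<exists>m'. I (Suc i) m' \<and> reach P k (pc, m) (pc, m')" and "I 0 m"
  shows "\<exists>m'. I n m' \<and> reach P (n * k) (pc, m) (pc, m')"
proof -
  have "j \<le> n \<Longrightarrow> \<exists>m'. I j m' \<and> reach P (j * k) (pc, m) (pc, m')" for j
  proof (induction j)
    case 0
    thus ?case using assms(2) reach_refl by auto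
  next
    case (Suc j)
    then obtain m1 where m1: "I j m1" "reach P (j * k) (pc, m) (pc, m1)" by auto
    then obtain m2 where "I (Suc j) m2" "reach P k (pc, m1) (pc, m2)" using assms(1)[of j m1] Suc by auto
    with reach_trans[OF m1(2) this(2)] show ?case by (auto simp: add.commute)
  qed
  thus ?thesis by simp
qed

section \<open>Straight-line blocks\<close>

fun exec_instr :: "instr \<Rightarrow> mem \<Rightarrow> mem option" where
  "exec_instr (Const i c) m = Some (m(i := of_int c))"
| "exec_instr (Add i j k) m = Some (m(i := m j + m k))"
| "exec_instr (Sub i j k) m = Some (m(i := m j - m k))"
| "exec_instr (Mul i j k) m = Some (m(i := m j * m k))"
| "exec_instr (Div i j k) m = Some (m(i := m j / m k))"
| "exec_instr (Sqrt i j) m = Some (m(i := sqrt (m j)))"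
| "exec_instr (Load i j) m = map_option (\<lambda>a. m(i := m a)) (addr (m j))"
| "exec_instr (Store i j) m = map_option (\<lambda>a. m(a := m i)) (addr (m j))"
| "exec_instr _ m = None"

text \<open>Jumps and \<open>Halt\<close> give \<open>None\<close>, so a successful run of a block
  advances the program counter by its length.\<close>

fun exec :: "instr list \<Rightarrow> mem \<Rightarrow> mem option" where
  "exec [] m = Some m"
| "exec (x # xs) m = Option.bind (exec_instr x m) (exec xs)"

lemma exec_append: "exec (xs @ ys) m = Option.bind (exec xs m) (exec ys)"
  by (induction xs arbitrary: m) (auto simp: bind_assoc cong: Option.bind_cong)

definition code_at :: "instr list \<Rightarrow> nat \<Rightarrow> instr list \<Rightarrow> bool" where
  "code_at P pc B \<longleftrightarrow> take (length B) (drop pc P) = B"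

lemma code_at_Cons: "code_at P pc (x # xs) \<longleftrightarrow> pc < length P \<and> P ! pc = x \<and> code_at P (Suc pc) xs"
proof (cases "pc < length P")
  case True
  hence "drop pc P = P ! pc # drop (Suc pc) P" by (simp add: Cons_nth_drop_Suc)
  thus ?thesis using True by (simp add: code_at_def)
qed (simp add: code_at_def)

lemma step_exec_instr:
  "exec_instr (P ! pc) m = Some m' \<Longrightarrow> pc < length P \<Longrightarrow> step P (pc, m) = Some (Suc pc, m')"
  by (cases "P ! pc") (auto simp: step_def)

lemma reach_exec:
  assumes "code_at P pc B" "exec B m = Some m'"
  shows "reach P (length B) (pc, m) (pc + length B, m')"
  using assms
proof (induction B arbitrary: pc m)
  case Nil
  thus ?case by (simp add: reach_refl)
next
  case (Cons x B)
  then obtain m1 where m1: "exec_instr x m = Some m1" "exec B m1 = Some m'"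
    by (auto simp: bind_eq_Some_conv)
  have "reach P 1 (pc, m) (Suc pc, m1)"
    using Cons.prems m1 by (intro reach_step step_exec_instr) (auto simp: code_at_Cons)
  moreover have "reach P (length B) (Suc pc, m1) (Suc pc + length B, m')"
    using Cons.IH[of "Suc pc" m1] Cons.prems m1 by (simp add: code_at_Cons)
  ultimately show ?case using reach_trans by fastforce
qed

lemma reach_JmpLe:
  assumes "code_at P pc [JmpLe i j l]"
  shows "m i \<le> m j \<Longrightarrow> reach P 1 (pc, m) (l, m)"
    and "\<not> m i \<le> m j \<Longrightarrow> reach P 1 (pc, m) (Suc pc, m)"
  using assms by (intro reach_step; simp add: step_def code_at_Cons)+

lemma reach_Jmp: "code_at P pc [Jmp l] \<Longrightarrow> reach P 1 (pc, m) (l, m)"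
  by (intro reach_step) (simp add: step_def code_at_Cons)

lemma addr_of_nat: "v = real p \<Longrightarrow> addr v = Some p"
  by (simp add: addr_def)

lemma addr_of_nat_simps [simp]:
  "addr (real p) = Some p" "addr (1 + real p) = Some (Suc p)" "addr (real p + 1) = Some (Suc p)"
  "addr (numeral k + real p) = Some (p + numeral k)" "addr (real p + numeral k) = Some (p + numeral k)"
  by (auto intro!: addr_of_nat)

section \<open>The program\<close>

text \<open>
  The input fills the registers from 0 on, so no fixed register is free at the start. Register 0 is
  turned into the pointer \<open>64 n\<close>, beyond the input, and registers 1 and 2 are parked there. Then
  register \<open>a\<close> is copied to \<open>3 n + a\<close> for \<open>a = 1, \<dots>, 30\<close> in turn, which extends the input
  periodically even when \<open>n < 10\<close>: registers 31 to \<open>30 + 3 n\<close> hold the disks rotated by ten places,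
  and registers 0 to 30 are free. Register 5 is the scan pointer, 6 the end of the disk table,
  7 and 25 the constants 1 and 0, and 8 to 10 the current disk; 0 to 3 hold the two centres and 4 the
  running maximum.
\<close>

definition load_code :: "instr list" where
  "load_code = [Load 8 5, Add 5 5 7, Load 9 5, Add 5 5 7, Load 10 5, Add 5 5 7]"

text \<open>Six doublings multiply by 64 without a constant register. The final zero in register 1
  lets the next jump test \<open>n = 0\<close>.\<close>

definition double_code :: "instr list" where
  "double_code = replicate 6 (Add 0 0 0) @ [Store 1 0, Const 1 0]"

text \<open>Register 2 is parked at \<open>64 * n + 1\<close>, \<open>3 * n + 1\<close> is computed
  in register 1, and the two parked values are moved to \<open>3 * n + 1\<close> and
  \<open>3 * n + 2\<close>. The copying therefore resumes at register 3.\<close>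

definition save_code :: "instr list" where
  "save_code =
    [Const 1 1, Add 0 0 1, Store 2 0, Sub 0 0 1,
     Const 1 64, Div 1 0 1, Const 2 3, Mul 1 1 2, Const 2 1, Add 1 1 2,
     Load 2 0, Store 2 1, Const 2 1, Add 0 0 2, Add 1 1 2, Load 2 0, Store 2 1, Const 2 1]"

definition copy_code :: "nat \<Rightarrow> instr list" where
  "copy_code k = concat (map (\<lambda>j. [Add 1 1 2, Store j 1]) [3..<k])"

text \<open>The initial \<open>p2\<close> is the rightmost point of the first disk, whose radius is
  the initial maximum.\<close>

definition init_code :: "instr list" where
  "init_code =
    [Const 7 1, Add 6 1 7, Const 25 0, Const 5 31, Load 0 5, Add 5 5 7, Load 1 5, Add 5 5 7,
     Load 4 5, Add 2 0 4, Add 3 1 25, Const 5 31]"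

definition dist_code :: "instr list" where
  "dist_code = load_code @
    [Sub 11 8 0, Sub 12 9 1, Mul 13 11 11, Mul 14 12 12, Add 13 13 14, Sqrt 13 13, Add 14 13 10]"

definition update_code :: "instr list" where
  "update_code =
    [Add 4 13 10, Div 11 11 13, Mul 11 11 10, Add 2 8 11, Div 12 12 13, Mul 12 12 10, Add 3 9 12]"

text \<open>Midpoint in 15 and 16, half distance in 17, unit axis in 18 and 19. Register 4 still
  holds the distance of the centres and serves as divisor before it is reset.\<close>

definition axis_code :: "instr list" where
  "axis_code =
    [Const 20 2, Add 15 0 2, Div 15 15 20, Add 16 1 3, Div 16 16 20, Sub 18 2 0, Div 18 18 4,
     Sub 19 3 1, Div 19 19 4, Div 17 4 20, Const 4 0, Const 5 31]"

text \<open>Absolute values are taken as square roots of squares.\<close>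

definition coord_code :: "instr list" where
  "coord_code =
    [Sub 11 8 15, Sub 12 9 16, Mul 13 11 18, Mul 14 12 19, Add 13 13 14, Mul 13 13 13, Sqrt 13 13,
     Mul 14 12 18, Mul 21 11 19, Sub 14 14 21, Mul 14 14 14, Sqrt 14 14]"

definition branch_code :: "instr list" where
  "branch_code =
    [Sub 21 17 13, Mul 22 21 21, Mul 23 14 14, Add 22 22 23, Sqrt 22 22, Mul 23 10 21, Mul 24 13 22]"

definition chord_code :: "instr list" where
  "chord_code =
    [Mul 23 10 10, Mul 24 13 13, Sub 23 23 24, Sqrt 23 23, Add 23 14 23, Mul 23 23 23,
     Mul 24 17 17, Add 23 23 24, Sqrt 23 23]"

text \<open>The loop heads are 95 and 130, the exit of the first loop is 118, the branches of the
  local radius join at 168, and 171 halts. \<open>Add 4 23 25\<close> is a move, as register 25 is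
  zero.\<close>

definition prog :: "instr list" where
  "prog = double_code @ [JmpLe 0 1 171] @ save_code @ copy_code 31 @ init_code @
    [JmpLe 6 5 118] @ dist_code @ [JmpLe 14 4 95] @ update_code @ [Jmp 95] @
    axis_code @ [JmpLe 6 5 171] @ load_code @ coord_code @ branch_code @ [JmpLe 23 24 167] @ chord_code @
    [Jmp 168] @ [Add 23 22 10] @ [JmpLe 23 4 130] @ [Add 4 23 25] @ [Jmp 130] @ [Halt]"

lemma prog_code:
  "code_at prog 0 double_code" "code_at prog 8 [JmpLe 0 1 171]" "code_at prog 9 save_code"
  "code_at prog 27 (copy_code 31)" "code_at prog 83 init_code"
  "code_at prog 95 [JmpLe 6 5 118]" "code_at prog 96 dist_code" "code_at prog 109 [JmpLe 14 4 95]"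
  "code_at prog 110 update_code" "code_at prog 117 [Jmp 95]"
  "code_at prog 118 axis_code" "code_at prog 130 [JmpLe 6 5 171]" "code_at prog 131 load_code"
  "code_at prog 137 coord_code" "code_at prog 149 branch_code" "code_at prog 156 [JmpLe 23 24 167]"
  "code_at prog 157 chord_code" "code_at prog 166 [Jmp 168]" "code_at prog 167 [Add 23 22 10]"
  "code_at prog 168 [JmpLe 23 4 130]" "code_at prog 169 [Add 4 23 25]" "code_at prog 170 [Jmp 130]"
  by code_simp+

lemma prog_halt: "halted prog (171, m)"
proof -
  have "171 < length prog" "prog ! 171 = Halt" by code_simp+
  thus ?thesis by (simp add: halted_def)
qed

lemma code_lengths:
  "length double_code = 8" "length save_code = 18" "length (copy_code 31) = 56" "length init_code = 12"
  "length load_code = 6" "length dist_code = 13" "length update_code = 7" "length axis_code = 12"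
  "length coord_code = 12" "length branch_code = 7" "length chord_code = 9"
  by code_simp+

section \<open>The disk table\<close>

definition stored :: "disk list \<Rightarrow> mem \<Rightarrow> bool" where
  "stored es m \<longleftrightarrow> m 6 = real (31 + 3 * length es) \<and> m 7 = 1 \<and> m 25 = 0 \<and>
     (\<forall>i<length es. m (31 + 3 * i) = Re (fst (es ! i)) \<and> m (32 + 3 * i) = Im (fst (es ! i)) \<and>
                    m (33 + 3 * i) = snd (es ! i))"

lemma stored_cong:
  assumes "stored es m" "\<And>a. a \<in> {6, 7, 25} \<or> a \<ge> 31 \<Longrightarrow> m' a = m a"
  shows "stored es m'"
  using assms by (simp add: stored_def)

lemma exec_load_code:
  assumes "stored es m" "i < length es" "m 5 = real (31 + 3 * i)"
  shows "exec load_code m =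
    Some (m(8 := Re (fst (es ! i)), 9 := Im (fst (es ! i)), 10 := snd (es ! i), 5 := real (31 + 3 * Suc i)))"
proof -
  define p where "p = 31 + 3 * i"
  have p: "p \<ge> 31" "m 5 = real p" "m 7 = 1" "real (31 + 3 * Suc i) = real p + 3"
    "m p = Re (fst (es ! i))" "m (p + 1) = Im (fst (es ! i))" "m (p + 2) = snd (es ! i)"
    using assms by (auto simp: p_def stored_def numeral_eq_Suc)
  \<comment> \<open>The table addresses read do not collide with registers 5, 8 and 9 written on the
    way.\<close>
  hence "p \<noteq> 4" "p \<noteq> 3" "p \<noteq> 6" "p \<noteq> 7" by auto
  thus ?thesis unfolding load_code_def p(4) using p
    by (simp add: fun_eq_iff)
qed

section \<open>Freeing the low registers\<close>

text \<open>The extension of the input with period \<open>3 * length ds\<close>; the shifts by one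
  reflect that the input starts at register 1.\<close>

definition cyclic :: "disk list \<Rightarrow> nat \<Rightarrow> real" where
  "cyclic ds a = init_mem ds ((a - 1) mod (3 * length ds) + 1)"

lemma cyclic_init: "1 \<le> a \<Longrightarrow> a \<le> 3 * length ds \<Longrightarrow> cyclic ds a = init_mem ds a"
  by (simp add: cyclic_def)

lemma cyclic_shift: "1 \<le> a \<Longrightarrow> cyclic ds (3 * length ds + a) = cyclic ds a"
  by (simp add: cyclic_def flip: add_diff_assoc)

lemma exec_copy_code:
  assumes "3 \<le> k" "n \<ge> 1" "n = length ds"
    and "m 1 = real (3 * n + 2)" "m 2 = 1" "\<And>a. 3 \<le> a \<Longrightarrow> a \<le> 3 * n + 2 \<Longrightarrow> m a = cyclic ds a"
  shows "\<exists>m'. exec (copy_code k) m = Some m' \<and> m' 1 = real (3 * n + k - 1) \<and> m' 2 = 1 \<and>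
    (\<forall>a. 3 \<le> a \<longrightarrow> a < 3 * n + k \<longrightarrow> m' a = cyclic ds a)"
  using assms(1)
proof (induction k rule: dec_induct)
  case base
  show ?case using assms by (simp add: copy_code_def)
next
  case (step k)
  then obtain m1 where m1: "exec (copy_code k) m = Some m1" "m1 1 = real (3 * n + k - 1)" "m1 2 = 1"
    "\<forall>a. 3 \<le> a \<longrightarrow> a < 3 * n + k \<longrightarrow> m1 a = cyclic ds a" by auto
  have "copy_code (Suc k) = copy_code k @ [Add 1 1 2, Store k 1]"
    using step by (simp add: copy_code_def)
  moreover have "m1 1 + m1 2 = real (3 * n + k)" using m1 step by (simp add: of_nat_diff)
  \<comment> \<open>The source may itself be a copy when \<open>k > 3 * n\<close>, but
    \<open>k < 3 * n + k\<close>, so it already holds its periodic value.\<close>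
  moreover have "m1 k = cyclic ds (3 * n + k)"
    using m1(4) step(1) assms(2,3) cyclic_shift[of k ds] by (cases ds) auto
  ultimately have "exec (copy_code (Suc k)) m = Some (m1(1 := real (3 * n + k), 3 * n + k := cyclic ds (3 * n + k)))"
    using step by (simp add: exec_append m1(1) del: of_nat_add of_nat_mult)
  thus ?case using m1 step assms(2) by (auto simp: less_Suc_eq)
qed

lemma exec_double_code:
  assumes "m 0 = real n" "n \<ge> 1"
  shows "exec double_code m = Some (m(0 := real (64 * n), 64 * n := m 1, 1 := 0))"
proof -
  have "exec double_code m = exec [Store 1 0, Const 1 0] (m(0 := real (64 * n)))"
    using assms by (simp add: double_code_def numeral_eq_Suc)
  thus ?thesis using assms by (simp del: of_nat_mult)
qed

lemma exec_save_code:
  assumes "m 0 = real A" "A = 64 * n" "n \<ge> 1"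
  shows "\<exists>m'. exec save_code m = Some m' \<and> m' 1 = real (3 * n + 2) \<and> m' 2 = 1 \<and>
     m' (3 * n + 1) = m A \<and> m' (3 * n + 2) = m 2 \<and> (\<forall>a. 3 \<le> a \<longrightarrow> a \<le> 3 * n \<longrightarrow> m' a = m a)"
proof -
  define B where "B = 3 * n"
  \<comment> \<open>The parked values lie above \<open>3 * n + 2\<close>, so the writes to
    \<open>3 * n + 1\<close> and \<open>3 * n + 2\<close> leave them intact.\<close>
  have AB: "real A / 64 * 3 = real B" "B \<ge> 3" "A > B + 2" using assms by (auto simp: B_def)
  have d: "A \<noteq> 0" "A \<noteq> 1" "A \<noteq> 2" "B \<noteq> 0" "B \<noteq> 1" "B \<noteq> 2" "A \<noteq> B" "A \<noteq> Suc B" "A \<noteq> Suc (Suc B)" "Suc A \<noteq> Suc (Suc B)"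
    "Suc A \<noteq> B" using AB by auto
  show ?thesis unfolding save_code_def B_def[symmetric] using assms(1) AB d
    by simp
qed

lemma init_mem_disk:
  assumes "k < length ds"
  shows "init_mem ds (3 * k + 1) = Re (fst (ds ! k))"
    "init_mem ds (3 * k + 2) = Im (fst (ds ! k))" "init_mem ds (3 * k + 3) = snd (ds ! k)"
proof -
  have "(3 * k + 1) div 3 = k" "(3 * k + 1) mod 3 = 1" "(3 * k + 2) div 3 = k" "(3 * k + 2) mod 3 = 2"
    by presburger+
  thus "init_mem ds (3 * k + 1) = Re (fst (ds ! k))"
    "init_mem ds (3 * k + 2) = Im (fst (ds ! k))" "init_mem ds (3 * k + 3) = snd (ds ! k)"
    using assms by (auto simp: init_mem_def Let_def)
qed

text \<open>Register 31 is thirty places, that is ten disks, after the start of the input.\<close>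

lemma cyclic_rotate:
  assumes "i < length ds"
  shows "cyclic ds (31 + 3 * i) = Re (fst (rotate 10 ds ! i))"
    "cyclic ds (32 + 3 * i) = Im (fst (rotate 10 ds ! i))" "cyclic ds (33 + 3 * i) = snd (rotate 10 ds ! i)"
proof -
  let ?n = "length ds" let ?j = "(10 + i) mod ?n"
  have j: "?j < ?n" using assms by (intro mod_less_divisor) auto
  have "(30 + 3 * i + q) mod (3 * ?n) = 3 * ?j + q" if "q < 3" for q
  proof -
    have "(30 + 3 * i + q) div 3 = 10 + i" "(30 + 3 * i + q) mod 3 = q" using that by presburger+
    thus ?thesis by (simp add: mod_mult2_eq)
  qed
  from this[of 0] this[of 1] this[of 2]
  have "cyclic ds (31 + 3 * i) = init_mem ds (3 * ?j + 1)" "cyclic ds (32 + 3 * i) = init_mem ds (3 * ?j + 2)"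
    "cyclic ds (33 + 3 * i) = init_mem ds (3 * ?j + 3)" by (auto simp: cyclic_def numeral_eq_Suc)
  thus "cyclic ds (31 + 3 * i) = Re (fst (rotate 10 ds ! i))"
    "cyclic ds (32 + 3 * i) = Im (fst (rotate 10 ds ! i))" "cyclic ds (33 + 3 * i) = snd (rotate 10 ds ! i)"
    using init_mem_disk[OF j] nth_rotate[OF assms, of 10] by auto
qed

lemma exec_init_code:
  assumes "m 1 = real (3 * n + 30)" "n = length es" "n \<ge> 1"
    and "\<And>i. i < n \<Longrightarrow> m (31 + 3 * i) = Re (fst (es ! i)) \<and> m (32 + 3 * i) = Im (fst (es ! i)) \<and>
                    m (33 + 3 * i) = snd (es ! i)"
  shows "\<exists>m'. exec init_code m = Some m' \<and> stored es m' \<and> m' 5 = 31 \<and>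
     m' 0 = Re (fst (es ! 0)) \<and> m' 1 = Im (fst (es ! 0)) \<and> m' 4 = snd (es ! 0) \<and>
     m' 2 = m' 0 + m' 4 \<and> m' 3 = m' 1"
proof -
  have a: "addr 31 = Some 31" "addr 32 = Some 32" "addr 33 = Some 33"
    by (simp_all add: addr_of_nat)
  have m: "m 31 = Re (fst (es ! 0))" "m 32 = Im (fst (es ! 0))" "m 33 = snd (es ! 0)"
    using assms(3) assms(4)[of 0] by auto
  show ?thesis unfolding init_code_def using assms a m
    by (auto simp: stored_def)
qed

text \<open>The only jump on the way is not taken, so 95 is both the step bound and the address
  reached.\<close>

lemma prologue:
  assumes "ds \<noteq> []"
  defines "es \<equiv> rotate 10 ds"
  shows "\<exists>m. reach prog 95 (0, init_mem ds) (95, m) \<and> stored es m \<and> m 5 = 31 \<and>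
     m 0 = Re (fst (es ! 0)) \<and> m 1 = Im (fst (es ! 0)) \<and> m 4 = snd (es ! 0) \<and>
     m 2 = m 0 + m 4 \<and> m 3 = m 1"
proof -
  define n where "n = length ds"
  have n: "n \<ge> 1" "n = length ds" using assms by (auto simp: n_def Suc_le_eq)
  define m0 where "m0 = init_mem ds"
  have "m0 0 = real n" by (simp add: m0_def init_mem_def n_def)
  note d = exec_double_code[of m0, OF this n(1)]
  define m1 where "m1 = m0(0 := real (64 * n), 64 * n := m0 1, 1 := 0)"
  have r1: "reach prog 8 (0, m0) (8, m1)"
    using reach_exec[OF prog_code(1) d] by (simp add: code_lengths m1_def)
  have m1: "m1 0 = real (64 * n)" "m1 (64 * n) = m0 1" "m1 2 = m0 2"
    "\<And>a. 3 \<le> a \<Longrightarrow> a \<le> 3 * n \<Longrightarrow> m1 a = m0 a" "m1 1 = 0"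
    using n(1) by (auto simp: m1_def)
  have r2: "reach prog 1 (8, m1) (9, m1)"
    using reach_JmpLe(2)[OF prog_code(2), of m1] m1 n(1) by simp
  obtain m2 where m2: "exec save_code m1 = Some m2" "m2 1 = real (3 * n + 2)" "m2 2 = 1"
     "m2 (3 * n + 1) = m0 1" "m2 (3 * n + 2) = m0 2" "\<And>a. 3 \<le> a \<Longrightarrow> a \<le> 3 * n \<Longrightarrow> m2 a = m0 a"
    using exec_save_code[of m1, OF m1(1) refl n(1)] m1 by auto
  have r3: "reach prog 18 (9, m1) (27, m2)"
    using reach_exec[OF prog_code(3) m2(1)] by (simp add: code_lengths)
  have c2: "m2 a = cyclic ds a" if "3 \<le> a" "a \<le> 3 * n + 2" for a
  proof -
    have "a \<le> 3 * n \<or> a = 3 * n + 1 \<or> a = 3 * n + 2" using that by auto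
    thus ?thesis
      using m2 that n cyclic_shift[of 1 ds] cyclic_shift[of 2 ds] cyclic_init[of 1 ds] cyclic_init[of 2 ds]
        cyclic_init[of a ds] by (auto simp: m0_def)
  qed
  obtain m3 where m3: "exec (copy_code 31) m2 = Some m3" "m3 1 = real (3 * n + 31 - 1)"
     "\<And>a. 3 \<le> a \<Longrightarrow> a < 3 * n + 31 \<Longrightarrow> m3 a = cyclic ds a"
    using exec_copy_code[of 31 n ds m2, OF _ n m2(2,3) c2] by auto
  have r4: "reach prog 56 (27, m2) (83, m3)"
    using reach_exec[OF prog_code(4) m3(1)] by (simp add: code_lengths)
  obtain m4 where m4: "exec init_code m3 = Some m4" "stored es m4" "m4 5 = 31"
     "m4 0 = Re (fst (es ! 0))" "m4 1 = Im (fst (es ! 0))" "m4 4 = snd (es ! 0)"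
     "m4 2 = m4 0 + m4 4" "m4 3 = m4 1"
    using exec_init_code[of m3 n es] m3 n cyclic_rotate[of _ ds] by (auto simp: es_def)
  have r5: "reach prog 12 (83, m3) (95, m4)"
    using reach_exec[OF prog_code(5) m4(1)] by (simp add: code_lengths)
  have "reach prog 95 (0, m0) (95, m4)"
    using reach_trans[OF reach_trans[OF reach_trans[OF reach_trans[OF r1 r2] r3] r4] r5] by simp
  thus ?thesis using m4 by (auto simp: m0_def)
qed

section \<open>The two scans\<close>

lemma exec_dist_code:
  assumes "stored es m" "i < length es" "m 5 = real (31 + 3 * i)"
  shows "\<exists>m'. exec dist_code m = Some m' \<and> m' 5 = real (31 + 3 * Suc i) \<and> stored es m' \<and>
     m' 8 = Re (fst (es ! i)) \<and> m' 9 = Im (fst (es ! i)) \<and> m' 10 = snd (es ! i) \<and>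
     m' 11 = m' 8 - m 0 \<and> m' 12 = m' 9 - m 1 \<and> m' 13 = dist (Complex (m 0) (m 1)) (fst (es ! i)) \<and>
     m' 14 = m' 13 + m' 10 \<and> (\<forall>a\<in>{0..4}. m' a = m a)"
proof -
  have d: "dist (Complex (m 0) (m 1)) (fst (es ! i)) =
      sqrt ((Re (fst (es ! i)) - m 0) * (Re (fst (es ! i)) - m 0) + (Im (fst (es ! i)) - m 1) * (Im (fst (es ! i)) - m 1))"
    by (simp add: dist_norm cmod_def power2_commute flip: power2_eq_square)
  show ?thesis unfolding dist_code_def exec_append exec_load_code[OF assms] d
    by (simp, intro conjI stored_cong[OF assms(1)]) auto
qed

lemma exec_update_code:
  "\<exists>m'. exec update_code m = Some m' \<and> m' 4 = m 13 + m 10 \<and> m' 2 = m 8 + m 11 / m 13 * m 10 \<and>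
     m' 3 = m 9 + m 12 / m 13 * m 10 \<and> (\<forall>a. a \<notin> {2, 3, 4, 11, 12} \<longrightarrow> m' a = m a)"
  unfolding update_code_def by simp

text \<open>The bound by the first radius keeps \<open>p2\<close> away from \<open>p1\<close> and
  prevents an update by a disk concentric with the first.\<close>

definition farthest_inv :: "disk list \<Rightarrow> nat \<Rightarrow> mem \<Rightarrow> bool" where
  "farthest_inv es i m \<longleftrightarrow> stored es m \<and> m 5 = real (31 + 3 * i) \<and>
     Complex (m 0) (m 1) = fst (es ! 0) \<and> Complex (m 2) (m 3) \<in> \<Union> (disk_set ` set es) \<and>
     dist (fst (es ! 0)) (Complex (m 2) (m 3)) = m 4 \<and> snd (es ! 0) \<le> m 4 \<and>
     (\<forall>j<i. dist (fst (es ! 0)) (fst (es ! j)) + snd (es ! j) \<le> m 4)"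

lemma farthest_step:
  assumes pos: "\<forall>d\<in>set es. snd d > 0"
    and antichain: "\<forall>d\<in>set es. \<forall>e\<in>set es. d \<noteq> e \<longrightarrow> \<not> disk_set d \<subseteq> disk_set e"
    and i: "i < length es" and inv: "farthest_inv es i m"
  shows "\<exists>m'. farthest_inv es (Suc i) m' \<and> reach prog 23 (95, m) (95, m')"
proof -
  let ?p = "fst (es ! 0)" and ?c = "fst (es ! i)" and ?R = "snd (es ! i)"
  have st: "stored es m" and m5: "m 5 = real (31 + 3 * i)" and p: "Complex (m 0) (m 1) = ?p"
    using inv by (auto simp: farthest_inv_def)
  have mem: "es ! i \<in> set es" "es ! 0 \<in> set es" using i by (auto intro: nth_mem)
  have r1: "reach prog 1 (95, m) (96, m)"
    using reach_JmpLe(2)[OF prog_code(6), of m] st m5 i by (simp add: stored_def)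
  obtain m1 where m1: "exec dist_code m = Some m1" "m1 5 = real (31 + 3 * Suc i)" "stored es m1"
     "m1 8 = Re ?c" "m1 9 = Im ?c" "m1 10 = ?R" "m1 11 = m1 8 - m 0" "m1 12 = m1 9 - m 1"
     "m1 13 = dist ?p ?c" "m1 14 = dist ?p ?c + ?R" "\<forall>a\<in>{0..4}. m1 a = m a"
    using exec_dist_code[of es m i, OF st i m5] p by auto
  have m1_eq: "m1 0 = m 0" "m1 1 = m 1" "m1 2 = m 2" "m1 3 = m 3" "m1 4 = m 4" using m1(11) by auto
  have r2: "reach prog 14 (95, m) (109, m1)"
    using reach_trans[OF r1] reach_exec[OF prog_code(7) m1(1)] by (fastforce simp: code_lengths)
  show ?thesis
  proof (cases "m1 14 \<le> m1 4")
    case True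
    have "farthest_inv es (Suc i) m1"
      using inv m1 m1_eq True by (auto simp: farthest_inv_def less_Suc_eq)
    moreover have "reach prog 23 (95, m) (95, m1)"
      using reach_trans[OF r2 reach_JmpLe(1)[OF prog_code(8), of m1, OF True]] by (rule reach_mono) simp
    ultimately show ?thesis by blast
  next
    case False
    hence gt: "m 4 < dist ?p ?c + ?R" using m1 m1_eq by simp
    \<comment> \<open>The update divides by this distance. A concentric disk that triggered it would
      be larger than the first disk and contain it, against the antichain condition.\<close>
    have d0: "dist ?p ?c > 0"
    proof (rule ccontr)
      assume "\<not> dist ?p ?c > 0"
      hence "?c = ?p" by simp
      moreover from this have "snd (es ! 0) < ?R" using gt inv by (simp add: farthest_inv_def)
      ultimately have "disk_set (es ! 0) \<subseteq> disk_set (es ! i)" "es ! 0 \<noteq> es ! i"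
        by (auto simp: disk_set_def)
      thus False using antichain mem by blast
    qed
    obtain m2 where m2: "exec update_code m1 = Some m2" "m2 4 = m1 13 + m1 10"
      "m2 2 = m1 8 + m1 11 / m1 13 * m1 10" "m2 3 = m1 9 + m1 12 / m1 13 * m1 10"
      "\<forall>a. a \<notin> {2, 3, 4, 11, 12} \<longrightarrow> m2 a = m1 a"
      using exec_update_code by blast
    define k where "k = ?R / dist ?p ?c"
    have R: "?R > 0" using pos mem by simp
    have k: "k \<ge> 0" "k * dist ?p ?c = ?R" using R d0 by (auto simp: k_def)
    have "m 0 = Re ?p" "m 1 = Im ?p" using p by (metis complex.sel)+
    \<comment> \<open>The point of the disk farthest from \<open>p1\<close>: beyond the disk centre
      on the ray from \<open>p1\<close>.\<close>
    hence z: "Complex (m2 2) (m2 3) = ?c + of_real k * (?c - ?p)"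
      by (simp add: complex_eq_iff k_def m1(4-9) m2(3,4) mult.commute)
    have "dist ?c (Complex (m2 2) (m2 3)) = ?R"
      using k by (simp add: z dist_norm norm_mult norm_minus_commute[of ?p])
    hence U: "Complex (m2 2) (m2 3) \<in> \<Union> (disk_set ` set es)"
      using mem by (intro UnionI[of "disk_set (es ! i)"]) (auto simp: disk_set_def)
    have "dist ?p (Complex (m2 2) (m2 3)) = cmod (of_real (1 + k) * (?c - ?p))"
      unfolding z dist_commute[of ?p] by (simp add: dist_norm algebra_simps)
    also have "\<dots> = (1 + k) * dist ?p ?c"
      using k(1) unfolding norm_mult norm_of_real by (simp add: dist_norm norm_minus_commute[of ?p])
    also have "\<dots> = m2 4" using k(2) by (simp add: m1(6,9) m2(2) algebra_simps)
    finally have dz: "dist ?p (Complex (m2 2) (m2 3)) = m2 4" .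
    have "stored es m2" by (rule stored_cong[OF m1(3)]) (use m2 in auto)
    hence "farthest_inv es (Suc i) m2"
      using inv m1 m2 m1_eq U dz gt p by (auto simp: farthest_inv_def less_Suc_eq intro: order.trans)
    moreover have "reach prog 1 (109, m1) (110, m1)"
      using reach_JmpLe(2)[OF prog_code(8), of m1, OF False] by simp
    from reach_trans[OF reach_trans[OF r2 this] reach_exec[OF prog_code(9) m2(1), unfolded code_lengths]]
    have "reach prog 22 (95, m) (117, m2)" by simp
    from reach_trans[OF this reach_Jmp[OF prog_code(10)]] have "reach prog 23 (95, m) (95, m2)" by simp
    ultimately show ?thesis by blast
  qed
qed

section \<open>The scan for the covering radius\<close>

text \<open>The last conjunct is the optimality certificate for \<open>two_center_opt_ge\<close>;
  its first alternative covers the start of the scan.\<close>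

definition cover_inv :: "disk list \<Rightarrow> complex \<Rightarrow> complex \<Rightarrow> nat \<Rightarrow> mem \<Rightarrow> bool" where
  "cover_inv es p1 p2 i m \<longleftrightarrow> stored es m \<and> m 5 = real (31 + 3 * i) \<and>
     Complex (m 0) (m 1) = p1 \<and> Complex (m 2) (m 3) = p2 \<and>
     Complex (m 15) (m 16) = (p1 + p2) / 2 \<and> m 17 = dist p1 p2 / 2 \<and>
     Complex (m 18) (m 19) = (p2 - p1) / of_real (dist p1 p2) \<and> 0 \<le> m 4 \<and>
     (\<forall>j<i. disk_set (es ! j) \<subseteq> cball p1 (m 4) \<union> cball p2 (m 4)) \<and>
     (m 4 = 0 \<or> (\<exists>x\<in>\<Union> (disk_set ` set es). m 4 \<le> dist p1 x \<and> m 4 \<le> dist p2 x))"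

lemma exec_axis_code:
  assumes "stored es m" "m 4 = dist (Complex (m 0) (m 1)) (Complex (m 2) (m 3))"
  shows "\<exists>m'. exec axis_code m = Some m' \<and>
    cover_inv es (Complex (m 0) (m 1)) (Complex (m 2) (m 3)) 0 m'"
  unfolding axis_code_def cover_inv_def
  by (simp add: complex_eq_iff assms(2), intro conjI stored_cong[OF assms(1)]) auto

lemma exec_coord_code:
  assumes "z = (Complex (m 8) (m 9) - Complex (m 15) (m 16)) * cnj (Complex (m 18) (m 19))"
  shows "\<exists>m'. exec coord_code m = Some m' \<and> m' 13 = \<bar>Re z\<bar> \<and> m' 14 = \<bar>Im z\<bar> \<and>
    (\<forall>a. a \<notin> {11, 12, 13, 14, 21} \<longrightarrow> m' a = m a)"
proof -
  have "Re z = (m 8 - m 15) * m 18 + (m 9 - m 16) * m 19"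
    "Im z = (m 9 - m 16) * m 18 - (m 8 - m 15) * m 19"
    by (simp_all add: assms)
  thus ?thesis unfolding coord_code_def by simp
qed

lemma exec_branch_code:
  "\<exists>m'. exec branch_code m = Some m' \<and> m' 22 = sqrt ((m 17 - m 13)\<^sup>2 + (m 14)\<^sup>2) \<and>
    m' 23 = m 10 * (m 17 - m 13) \<and> m' 24 = m 13 * m' 22 \<and> (\<forall>a. a \<notin> {21, 22, 23, 24} \<longrightarrow> m' a = m a)"
  unfolding branch_code_def by (simp add: power2_eq_square)

lemma exec_chord_code:
  "\<exists>m'. exec chord_code m = Some m' \<and>
    m' 23 = sqrt ((m 14 + sqrt ((m 10)\<^sup>2 - (m 13)\<^sup>2))\<^sup>2 + (m 17)\<^sup>2) \<and> (\<forall>a. a \<notin> {23, 24} \<longrightarrow> m' a = m a)"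
  unfolding chord_code_def by (simp add: power2_eq_square)

text \<open>The chord branch costs \<open>7 + 1 + 9 + 1\<close> steps; the shorter branch is padded
  to this bound.\<close>

lemma reach_local_radius:
  "\<exists>m'. reach prog 18 (149, m) (168, m') \<and> m' 23 = local_radius (m 17) (m 13) (m 14) (m 10) \<and>
    (\<forall>a. a \<notin> {21, 22, 23, 24} \<longrightarrow> m' a = m a)"
proof -
  obtain m1 where m1: "exec branch_code m = Some m1" "m1 22 = sqrt ((m 17 - m 13)\<^sup>2 + (m 14)\<^sup>2)"
    "m1 23 = m 10 * (m 17 - m 13)" "m1 24 = m 13 * m1 22" "\<forall>a. a \<notin> {21, 22, 23, 24} \<longrightarrow> m1 a = m a"
    using exec_branch_code by blast
  have r1: "reach prog 7 (149, m) (156, m1)"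
    using reach_exec[OF prog_code(15) m1(1)] by (simp add: code_lengths)
  show ?thesis
  proof (cases "m1 23 \<le> m1 24")
    case True
    let ?m = "m1(23 := m1 22 + m1 10)"
    have "reach prog 1 (156, m1) (167, m1)" by (rule reach_JmpLe(1)[OF prog_code(16) True])
    moreover have "reach prog 1 (167, m1) (168, ?m)"
      using reach_exec[OF prog_code(19), of m1 ?m] by simp
    ultimately have "reach prog (7 + (1 + 1)) (149, m) (168, ?m)" using r1 reach_trans by blast
    hence "reach prog 18 (149, m) (168, ?m)" by (rule reach_mono) simp
    thus ?thesis using m1 True by (intro exI[of _ ?m]) (auto simp: local_radius_def)
  next
    case False
    obtain m2 where m2: "exec chord_code m1 = Some m2"
      "m2 23 = sqrt ((m1 14 + sqrt ((m1 10)\<^sup>2 - (m1 13)\<^sup>2))\<^sup>2 + (m1 17)\<^sup>2)"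
      "\<forall>a. a \<notin> {23, 24} \<longrightarrow> m2 a = m1 a"
      using exec_chord_code by blast
    have "reach prog 1 (156, m1) (157, m1)"
      using reach_JmpLe(2)[OF prog_code(16), of m1, OF False] by simp
    moreover have "reach prog 9 (157, m1) (166, m2)"
      using reach_exec[OF prog_code(17) m2(1)] by (simp add: code_lengths)
    moreover have "reach prog 1 (166, m2) (168, m2)" by (rule reach_Jmp[OF prog_code(18)])
    ultimately have "reach prog (7 + (1 + (9 + 1))) (149, m) (168, m2)" using r1 reach_trans by blast
    thus ?thesis using m1 m2 False by (intro exI[of _ m2]) (auto simp: local_radius_def)
  qed
qed

text \<open>Register 4 becomes the maximum of its value and \<open>\<rho>\<close>. Earlier covers
  survive a larger radius, and a new maximum brings its own witness from
  \<open>disk_local_radius\<close>.\<close>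

lemma cover_step:
  assumes pos: "\<forall>d\<in>set es. snd d > 0" and ne: "p1 \<noteq> p2"
    and i: "i < length es" and inv: "cover_inv es p1 p2 i m"
  shows "\<exists>m'. cover_inv es p1 p2 (Suc i) m' \<and> reach prog 40 (130, m) (130, m')"
proof -
  let ?c = "fst (es ! i)" and ?R = "snd (es ! i)"
  let ?q = "(p1 + p2) / 2" and ?u = "(p2 - p1) / of_real (dist p1 p2)" and ?L = "dist p1 p2 / 2"
  define z where "z = (?c - ?q) * cnj ?u"
  define \<rho> where "\<rho> = local_radius ?L \<bar>Re z\<bar> \<bar>Im z\<bar> ?R"
  have st: "stored es m" and m5: "m 5 = real (31 + 3 * i)" using inv by (auto simp: cover_inv_def)
  have r1: "reach prog 1 (130, m) (131, m)"
    using reach_JmpLe(2)[OF prog_code(12), of m] st m5 i by (simp add: stored_def)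
  define m1 where "m1 = m(8 := Re ?c, 9 := Im ?c, 10 := ?R, 5 := real (31 + 3 * Suc i))"
  have r2: "reach prog 6 (131, m) (137, m1)"
    using reach_exec[OF prog_code(13) exec_load_code[OF st i m5]] by (simp add: code_lengths m1_def)
  have "z = (Complex (m1 8) (m1 9) - Complex (m1 15) (m1 16)) * cnj (Complex (m1 18) (m1 19))"
    using inv by (simp add: z_def m1_def cover_inv_def)
  from exec_coord_code[of z m1, OF this]
  obtain m2 where m2: "exec coord_code m1 = Some m2" "m2 13 = \<bar>Re z\<bar>" "m2 14 = \<bar>Im z\<bar>"
    "\<forall>a. a \<notin> {11, 12, 13, 14, 21} \<longrightarrow> m2 a = m1 a" by blast
  have r3: "reach prog 12 (137, m1) (149, m2)"
    using reach_exec[OF prog_code(14) m2(1)] by (simp add: code_lengths)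
  obtain m3 where r4: "reach prog 18 (149, m2) (168, m3)"
    and m3: "m3 23 = local_radius (m2 17) (m2 13) (m2 14) (m2 10)" "\<forall>a. a \<notin> {21, 22, 23, 24} \<longrightarrow> m3 a = m2 a"
    using reach_local_radius by blast
  have r5: "reach prog (1 + (6 + (12 + 18))) (130, m) (168, m3)"
    using r1 r2 r3 r4 reach_trans by blast
  have "m 17 = ?L" using inv by (simp only: cover_inv_def)
  hence m3_rho: "m3 23 = \<rho>" using m3 m2 by (simp add: \<rho>_def m1_def del: eq_divide_eq_numeral1)
  have m3_eq: "m3 a = m a" if "a \<notin> {5, 8, 9, 10, 11, 12, 13, 14, 21, 22, 23, 24}" for a
    using that m3(2) m2(4) by (simp add: m1_def)
  have m3_5: "m3 5 = real (31 + 3 * Suc i)" using m3(2) m2(4) by (simp add: m1_def)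
  have st3: "stored es m3" by (rule stored_cong[OF st], rule m3_eq) auto
  have q: "p1 = ?q - of_real ?L * ?u" "p2 = ?q + of_real ?L * ?u"
    using ne by (simp_all add: field_simps)
  have u1: "cmod ?u = 1" using ne by (simp add: norm_divide dist_norm norm_minus_commute)
  have R: "?R > 0" using pos i by simp
  have cov: "disk_set (es ! i) \<subseteq> cball p1 \<rho> \<union> cball p2 \<rho>"
    and att: "\<exists>x\<in>disk_set (es ! i). \<rho> \<le> dist p1 x \<and> \<rho> \<le> dist p2 x"
    using disk_local_radius[OF u1 R, of ?L ?c ?q] unfolding z_def[symmetric] \<rho>_def[symmetric] q[symmetric] disk_set_def
    by simp_all
  have mono: "A \<subseteq> cball p1 r' \<union> cball p2 r'" if "A \<subseteq> cball p1 r \<union> cball p2 r" "r \<le> r'" for A r r'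
    using that by fastforce
  show ?thesis
  proof (cases "m3 23 \<le> m3 4")
    case True
    have "cover_inv es p1 p2 (Suc i) m3"
      using inv st3 m3_5 mono[OF cov] True by (auto simp: cover_inv_def m3_eq m3_rho less_Suc_eq)
    moreover have "reach prog 40 (130, m) (130, m3)"
      using reach_trans[OF r5 reach_JmpLe(1)[OF prog_code(20) True]] by (rule reach_mono) simp
    ultimately show ?thesis by blast
  next
    case False
    define m4 where "m4 = m3(4 := m3 23)"
    have "m3 25 = 0" using st3 by (simp add: stored_def)
    hence "reach prog 1 (169, m3) (170, m4)"
      using reach_exec[OF prog_code(21), of m3 m4] by (simp add: m4_def)
    moreover have "reach prog 1 (168, m3) (169, m3)"
      using reach_JmpLe(2)[OF prog_code(20), of m3, OF False] by simp
    moreover have "reach prog 1 (170, m4) (130, m4)" by (rule reach_Jmp[OF prog_code(22)])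
    ultimately have "reach prog (1 + (6 + (12 + 18)) + (1 + (1 + 1))) (130, m) (130, m4)"
      using r5 reach_trans by blast
    hence r6: "reach prog 40 (130, m) (130, m4)" by (rule reach_mono) simp
    have st4: "stored es m4" by (rule stored_cong[OF st3]) (auto simp: m4_def)
    have lt: "m 4 < \<rho>" using False by (simp add: m3_rho m3_eq)
    have att': "\<exists>x\<in>\<Union> (disk_set ` set es). \<rho> \<le> dist p1 x \<and> \<rho> \<le> dist p2 x"
      using att i by (meson UN_I nth_mem)
    have cov': "disk_set (es ! j) \<subseteq> cball p1 \<rho> \<union> cball p2 \<rho>" if "j < Suc i" for j
    proof (cases "j = i")
      case False
      hence "disk_set (es ! j) \<subseteq> cball p1 (m 4) \<union> cball p2 (m 4)"
        using that inv by (simp add: cover_inv_def)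
      thus ?thesis using lt by (intro mono[of _ "m 4" \<rho>]) auto
    qed (use cov in simp)
    have m4_eq: "m4 4 = \<rho>" "m4 5 = real (31 + 3 * Suc i)" "m4 0 = m 0" "m4 1 = m 1" "m4 2 = m 2" "m4 3 = m 3"
      "m4 15 = m 15" "m4 16 = m 16" "m4 17 = m 17" "m4 18 = m 18" "m4 19 = m 19"
      using m3_5 by (simp_all add: m4_def m3_eq m3_rho)
    have "cover_inv es p1 p2 (Suc i) m4"
      unfolding cover_inv_def m4_eq using st4 inv cov' att' lt by (simp add: cover_inv_def)
    thus ?thesis using r6 by blast
  qed
qed

lemma prog_correct:
  assumes "ds \<noteq> []" and pos: "\<forall>d\<in>set ds. snd d > 0"
    and antichain: "\<forall>d\<in>set ds. \<forall>e\<in>set ds. d \<noteq> e \<longrightarrow> \<not> disk_set d \<subseteq> disk_set e"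
  defines "U \<equiv> \<Union> (disk_set ` set ds)"
  shows "\<exists>m. run prog (109 * (length ds + 1)) (0, init_mem ds) = Some (171, m) \<and> 0 \<le> m 4 \<and>
     U \<subseteq> cball (Complex (m 0) (m 1)) (m 4) \<union> cball (Complex (m 2) (m 3)) (m 4) \<and>
     m 4 \<le> 2 * two_center_opt U"
proof -
  define es where "es = rotate 10 ds"
  define n where "n = length ds"
  have es: "set es = set ds" "length es = n" by (auto simp: es_def n_def)
  have "es ! 0 \<in> set es" using assms(1) es by (intro nth_mem) (simp add: n_def)
  hence R0: "snd (es ! 0) > 0" and mem0: "es ! 0 \<in> set ds" using pos es by auto
  let ?p1 = "fst (es ! 0)"
  obtain m1 where r1: "reach prog 95 (0, init_mem ds) (95, m1)" and m1: "stored es m1" "m1 5 = 31"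
     "m1 0 = Re ?p1" "m1 1 = Im ?p1" "m1 4 = snd (es ! 0)" "m1 2 = m1 0 + m1 4" "m1 3 = m1 1"
    using prologue[OF assms(1)] unfolding es_def by blast
  have "Complex (m1 2) (m1 3) = ?p1 + of_real (snd (es ! 0))" using m1 by (simp add: complex_eq_iff)
  hence "farthest_inv es 0 m1"
    unfolding farthest_inv_def es(1)
    using m1 R0 mem0 by (auto simp: dist_norm disk_set_def intro!: bexI[of _ "es ! 0"])
  then obtain m2 where m2: "farthest_inv es n m2" and r2: "reach prog (n * 23) (95, m1) (95, m2)"
    using reach_loop[of n "farthest_inv es" prog 23 95 m1] farthest_step[of es] pos antichain
    unfolding es(1)[symmetric] es(2)[symmetric] by blast
  define p2 where "p2 = Complex (m2 2) (m2 3)"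
  have p: "Complex (m2 0) (m2 1) = ?p1" "dist ?p1 p2 = m2 4" "p2 \<in> U" "?p1 \<noteq> p2" "m2 4 > 0"
    using m2 R0 es by (auto simp: farthest_inv_def p2_def U_def)
  have far: "dist ?p1 x \<le> dist ?p1 p2" if x: "x \<in> U" for x
  proof -
    obtain d where "d \<in> set es" "x \<in> disk_set d" using x es unfolding U_def by blast
    then obtain j where j: "j < n" "x \<in> disk_set (es ! j)" using es(2) by (auto simp: in_set_conv_nth)
    hence "dist ?p1 (fst (es ! j)) + snd (es ! j) \<le> dist ?p1 p2"
      using m2 p(2) by (simp add: farthest_inv_def)
    thus ?thesis using j(2) dist_triangle[of ?p1 x "fst (es ! j)"] by (simp add: disk_set_def)
  qed
  have r3: "reach prog 1 (95, m2) (118, m2)"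
    using m2 es by (intro reach_JmpLe(1)[OF prog_code(6)]) (simp add: farthest_inv_def stored_def)
  obtain m3 where m3: "exec axis_code m2 = Some m3" "cover_inv es ?p1 p2 0 m3"
    using exec_axis_code[of es m2] m2 p by (auto simp: farthest_inv_def p2_def)
  have r4: "reach prog 12 (118, m2) (130, m3)"
    using reach_exec[OF prog_code(11) m3(1)] by (simp add: code_lengths)
  obtain m4 where m4: "cover_inv es ?p1 p2 n m4" and r5: "reach prog (n * 40) (130, m3) (130, m4)"
    using reach_loop[of n "cover_inv es ?p1 p2" prog 40 130 m3] cover_step[of es ?p1 p2] pos p(4) m3(2)
    unfolding es(1)[symmetric] es(2)[symmetric] by blast
  have r6: "reach prog 1 (130, m4) (171, m4)"
    using m4 es by (intro reach_JmpLe(1)[OF prog_code(12)]) (simp add: cover_inv_def stored_def)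
  \<comment> \<open>The total is \<open>109 + 63 * n\<close>, hence at most
    \<open>109 * (n + 1)\<close>.\<close>
  have "reach prog (95 + (n * 23 + (1 + (12 + (n * 40 + 1))))) (0, init_mem ds) (171, m4)"
    by (rule reach_trans[OF r1 reach_trans[OF r2 reach_trans[OF r3 reach_trans[OF r4 reach_trans[OF r5 r6]]]]])
  hence "reach prog (109 * (length ds + 1)) (0, init_mem ds) (171, m4)"
    by (rule reach_mono) (simp add: n_def)
  hence run: "run prog (109 * (length ds + 1)) (0, init_mem ds) = Some (171, m4)"
    using prog_halt by (rule reach_halted)
  have c: "Complex (m4 0) (m4 1) = ?p1" "Complex (m4 2) (m4 3) = p2" "0 \<le> m4 4"
    "m4 4 = 0 \<or> (\<exists>x\<in>U. m4 4 \<le> dist ?p1 x \<and> m4 4 \<le> dist p2 x)"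
    "\<And>j. j < n \<Longrightarrow> disk_set (es ! j) \<subseteq> cball ?p1 (m4 4) \<union> cball p2 (m4 4)"
    using m4 es by (auto simp: cover_inv_def U_def)
  have "disk_set d \<subseteq> cball ?p1 (m4 4) \<union> cball p2 (m4 4)" if "d \<in> set ds" for d
    using that es c(5) by (metis in_set_conv_nth)
  hence U: "U \<subseteq> cball ?p1 (m4 4) \<union> cball p2 (m4 4)" unfolding U_def by blast
  have "?p1 \<in> U" using mem0 R0 by (auto simp: U_def disk_set_def intro!: bexI[of _ "es ! 0"])
  hence "m4 4 \<le> 2 * two_center_opt U" using U c p far by (intro two_center_opt_ge) auto
  thus ?thesis using run c U by auto
qed

text \<open>All registers are zero and stay so: the parking address is register 0, and the first
  jump goes straight to \<open>Halt\<close>.\<close>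

lemma prog_empty:
  "\<exists>m. run prog 9 (0, init_mem []) = Some (171, m) \<and> m 4 = 0"
proof -
  have a: "addr 0 = Some 0" by (simp add: addr_of_nat)
  have z: "init_mem [] = (\<lambda>_. 0)" by (auto simp: init_mem_def)
  have "exec double_code (\<lambda>_. 0) = Some (\<lambda>_. 0)"
    by (simp add: double_code_def numeral_eq_Suc a fun_upd_idem)
  from reach_exec[OF prog_code(1) this] have "reach prog 8 (0, init_mem []) (8, \<lambda>_. 0)"
    by (simp add: code_lengths z)
  from reach_trans[OF this reach_JmpLe(1)[OF prog_code(2)]]
  have "reach prog 9 (0, init_mem []) (171, \<lambda>_. 0)" by simp
  thus ?thesis using reach_halted prog_halt by blast
qed

theorem theorem3:
  shows "\<exists>(P :: instr list) (c :: real). \<forall>ds :: disk list.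
     (\<forall>d\<in>set ds. snd d > 0) \<and>
     (\<forall>i<length ds. \<forall>j<length ds. i \<noteq> j \<longrightarrow> \<not> disk_set (ds ! i) \<subseteq> disk_set (ds ! j))
     \<longrightarrow> (\<exists>k pc m. real k \<le> c * real (length ds + 1) \<and>
            run P k (0, init_mem ds) = Some (pc, m) \<and>
            (let U = \<Union> (disk_set ` set ds); r = m 4 in
               r \<ge> 0 \<and>
               U \<subseteq> cball (Complex (m 0) (m 1)) r \<union> cball (Complex (m 2) (m 3)) r \<and>
               r \<le> 2 * two_center_opt U))"
proof -
  have correct: "\<exists>k pc m. real k \<le> 109 * real (length ds + 1) \<and>
            run prog k (0, init_mem ds) = Some (pc, m) \<and>
            (let U = \<Union> (disk_set ` set ds); r = m 4 in
               r \<ge> 0 \<and>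
               U \<subseteq> cball (Complex (m 0) (m 1)) r \<union> cball (Complex (m 2) (m 3)) r \<and>
               r \<le> 2 * two_center_opt U)"
    if asm: "(\<forall>d\<in>set ds. snd d > 0) \<and>
     (\<forall>i<length ds. \<forall>j<length ds. i \<noteq> j \<longrightarrow> \<not> disk_set (ds ! i) \<subseteq> disk_set (ds ! j))"
    for ds :: "disk list"
  proof (cases "ds = []")
    case True
    have "0 \<le> two_center_opt {}"
      unfolding two_center_opt_def by (intro cInf_greatest) auto
    moreover obtain m where "run prog 9 (0, init_mem []) = Some (171, m)" "m 4 = 0"
      using prog_empty by blast
    ultimately show ?thesis using True by (intro exI[of _ 9] exI[of _ 171] exI[of _ m]) simp
  next
    case False
    have "\<forall>d\<in>set ds. \<forall>e\<in>set ds. d \<noteq> e \<longrightarrow> \<not> disk_set d \<subseteq> disk_set e"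
      using asm by (metis in_set_conv_nth)
    from prog_correct[OF False _ this] asm
    obtain m where "run prog (109 * (length ds + 1)) (0, init_mem ds) = Some (171, m)" "0 \<le> m 4"
      "\<Union> (disk_set ` set ds) \<subseteq> cball (Complex (m 0) (m 1)) (m 4) \<union> cball (Complex (m 2) (m 3)) (m 4)"
      "m 4 \<le> 2 * two_center_opt (\<Union> (disk_set ` set ds))" by blast
    thus ?thesis unfolding Let_def
      by (intro exI[of _ "109 * (length ds + 1)"] exI[of _ 171] exI[of _ m] conjI) simp_all
  qed
  show ?thesis by (rule exI[of _ prog], rule exI[of _ 109], intro allI impI, rule correct)
qed

end
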